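(* Let $S$ be a $d\times d$ parity indicative symmetric matrix over $\mathbb{Z}_2$. Let $K>2d-\operatorname{rank}(S)$. Let $\alpha\in\mathbb{Z}_2^K$ be a nonzero vector such that $\|\alpha\|_0\equiv\operatorname{Tr}(S)\pmod 2$. Then there exists a $K$-element frame $\mathcal{F}=\{f_i\}_{i=1}^K$ for $\mathbb{Z}_2^d$ such that $S=\Theta_{\mathcal{F}}\Theta_{\mathcal{F}}^*$ and $(f_i,f_i)=\alpha[i]$ for every $i$.
   Context: All vectors and matrices have entries in the two-element field $\mathbb{Z}_2$ and all operations (including rank and trace) are over $\mathbb{Z}_2$; $d\ge 1$. The dot product is $(a,b)=\sum_n a[n]b[n]$. A (binary) frame for $\mathbb{Z}_2^d$ is a finite sequence of vectors $\{f_j\}_{j=1}^K$ (repetitions and zero vectors allowed) whose span is $\mathbb{Z}_2^d$. Its synthesis operator $\Theta_{\mathcal{F}}$ is the $d\times K$ matrix whose $j$th column is $f_j$; $^*$ denotes transpose. $\|\alpha\|_0$ is the number of nonzero entries of $\alpha$. A vector $v$ is even if $(v,v)=0$ (equivalently $\|v\|_0$ is even) and odd otherwise. A $d\times d$ symmetric matrix $S$ is parity indicative if, for every $1\le i\le d$, $S_{ii}=1$ if and only if the $i$th row of $S$ is odd. *)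

theory Defs
  imports "HOL-Analysis.Analysis" "HOL-Library.Z2"
begin

text \<open>
  The field with two elements is \<^typ>\<open>bit\<close>. Vectors and matrices are indexed by finite types:
  the dimension \<open>d\<close> is \<open>CARD('d)\<close> and the number of frame elements \<open>K\<close> is \<open>CARD('k)\<close>, so a
  finite sequence of \<open>K\<close> vectors is a function \<open>'k \<Rightarrow> bit ^ 'd\<close>.
\<close>

definition dotp :: "bit ^ 'n \<Rightarrow> bit ^ 'n \<Rightarrow> bit"
  where "dotp a b = (\<Sum>n\<in>UNIV. a $ n * b $ n)"

definition norm0 :: "bit ^ 'n \<Rightarrow> nat"
  where "norm0 v = card {n. v $ n \<noteq> 0}"

definition even_vec :: "bit ^ 'n \<Rightarrow> bool"
  where "even_vec v \<longleftrightarrow> dotp v v = 0"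

definition is_frame :: "('k::finite \<Rightarrow> bit ^ 'd) \<Rightarrow> bool"
  where "is_frame f \<longleftrightarrow> vec.span (range f) = UNIV"

definition synthesis :: "('k::finite \<Rightarrow> bit ^ 'd) \<Rightarrow> bit ^ 'k ^ 'd"
  where "synthesis f = (\<chi> i j. f j $ i)"

text \<open>Symmetry is not part of this predicate; it is a separate hypothesis wherever it is needed.\<close>

definition parity_indicative :: "bit ^ 'd ^ 'd \<Rightarrow> bool"
  where "parity_indicative S \<longleftrightarrow> (\<forall>i. S $ i $ i = 1 \<longleftrightarrow> \<not> even_vec (row i S))"

end

theory Submission
  imports Defs
begin

text \<open>
  Read the matrix \<open>\<Theta>\<close> by rows instead of by columns. Its rows are the images of the standard
  basis under a linear map \<open>h\<close> from \<open>\<int>\<^sub>2\<^sup>d\<close> to \<open>\<int>\<^sub>2\<^sup>K\<close>, and the three requirements translate as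
  follows: the columns span iff \<open>h\<close> is injective; \<open>S = \<Theta> \<Theta>\<^sup>*\<close> iff \<open>h\<close> carries the form
  \<open>x\<^sup>* S y\<close> to the dot product; and, since squaring is the identity on \<open>\<int>\<^sub>2\<close>, the numbers
  \<open>(f\<^sub>i, f\<^sub>i)\<close> are the entries of the sum of the rows, so the last requirement is \<open>h 1 = \<alpha>\<close> for
  the all-ones vector \<open>1\<close>. Thus an isometric embedding with one prescribed value is wanted.
  Parity indicativeness says that \<open>S 1\<close> is the diagonal of \<open>S\<close>, that is,
  \<open>x\<^sup>* S x = x\<^sup>* S 1\<close>: the vector \<open>1\<close> is characteristic for the form. The parity condition on
  \<open>\<alpha>\<close> says that prescribing \<open>1 \<mapsto> \<alpha>\<close> is isometric.

  The embedding is built by extending a partial one, one vector \<open>v\<close> at a time, as in Witt's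
  theorem (\<open>extend_embedding\<close>). Suppose the all-ones vector of \<open>\<int>\<^sub>2\<^sup>K\<close> is the image of a
  characteristic vector. Then the quadratic condition on the image of \<open>v\<close> follows from the linear
  ones, because \<open>(a, a) = (a, 1)\<close>. The linear conditions have a solution, and the solutions form a
  coset of the orthogonal complement of the present image. The only obstacle is that all solutions
  may lie in the present image. If they do, some vector outside the present domain \<open>U\<close> is
  orthogonal to \<open>U\<close> and to itself, and the complement of the image lies in the image of the
  radical of \<open>U\<close>; comparing cardinalities then contradicts \<open>|V| |rad V| < 4 \<cdot> 2\<^sup>K\<close>.

  If \<open>\<alpha> = 1\<close> this applies to \<open>V = \<int>\<^sub>2\<^sup>d\<close> directly. Otherwise \<open>\<beta> = 1 + \<alpha>\<close> is nonzero and
  orthogonal to \<open>\<alpha>\<close>; the form is enlarged by an orthogonal summand spanned by one vector \<open>e\<close>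
  with \<open>(e, e) = (\<beta>, \<beta>)\<close>, and the extension starts from \<open>1 \<mapsto> \<alpha>\<close>, \<open>e \<mapsto> \<beta>\<close>, under which
  \<open>1 + e\<close> is a characteristic vector mapped to the all-ones vector. The enlargement multiplies
  \<open>|V|\<close> by 2 and \<open>|rad V|\<close> by at most 2, so \<open>K > 2d - rank S\<close> is just what is needed.

  All linear algebra is done by counting: one character sum (\<open>card_annihilators\<close>) gives the size
  of orthogonal complements, the solvability of linear systems, and the size of the radical.
\<close>

section \<open>Arithmetic modulo two\<close>

lemma UNIV_bit: "(UNIV :: bit set) = {0, 1}"
  by (auto intro: bit.exhaust)

instance bit :: finite
  by standard (simp add: UNIV_bit)

lemma CARD_bit [simp]: "CARD(bit) = 2"
  by (simp add: UNIV_bit)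

text \<open>These rules rewrite the field operations to Boolean ones and so block algebraic rules.\<close>
declare add_bit_eq_xor [simp del] mult_bit_eq_and [simp del]

lemma bit_double [simp]: "t + t = (0 :: bit)"
  by (cases t) auto

lemma bit_add_eq_0_iff [simp]: "s + t = 0 \<longleftrightarrow> s = (t :: bit)"
  by (cases s; cases t) auto

lemma bit_add_cancel: "s + t + (t + r) = s + (r :: bit)"
  by (cases t; cases s; cases r) auto

lemma bit_square [simp]: "t * t = (t :: bit)"
  by (cases t) auto

lemma bit_vec_double [simp]: "x + x = (0 :: bit ^ 'n)"
  by (simp add: vec_eq_iff)

section \<open>Subgroups and annihilators\<close>

text \<open>In a finite group this makes \<open>H\<close> closed under negation as well.\<close>
definition add_subgroup :: "'a::ab_group_add set \<Rightarrow> bool"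
  where "add_subgroup H \<longleftrightarrow> 0 \<in> H \<and> (\<forall>x\<in>H. \<forall>y\<in>H. x + y \<in> H)"

definition additive_on :: "'a::ab_group_add set \<Rightarrow> ('a \<Rightarrow> 'b::ab_group_add) \<Rightarrow> bool"
  where "additive_on H f \<longleftrightarrow> (\<forall>x\<in>H. \<forall>y\<in>H. f (x + y) = f x + f y)"

text \<open>The nontrivial additive character of \<open>\<int>\<^sub>2\<close>.\<close>
definition sign :: "bit \<Rightarrow> int"
  where "sign t = (if t = 0 then 1 else - 1)"

text \<open>If \<open>f a = 1\<close>, translation by \<open>a\<close> permutes \<open>H\<close> and flips every sign, so the sum is its
  own negative.\<close>
lemma sum_sign_additive:
  fixes f :: "'a::{finite,ab_group_add} \<Rightarrow> bit"
  assumes H: "add_subgroup H" and f: "additive_on H f"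
  shows "(\<Sum>x\<in>H. sign (f x)) = (if \<forall>x\<in>H. f x = 0 then int (card H) else 0)"
proof (cases "\<forall>x\<in>H. f x = 0")
  case True
  then show ?thesis by (simp add: sign_def)
next
  case False
  then obtain a where a: "a \<in> H" "f a = 1" by auto
  have "(\<lambda>x. x + a) ` H = H"
    using H a by (intro endo_inj_surj) (auto simp: add_subgroup_def)
  then have "(\<Sum>x\<in>H. sign (f x)) = (\<Sum>x\<in>(\<lambda>x. x + a) ` H. sign (f x))"
    by simp
  also have "\<dots> = (\<Sum>x\<in>H. sign (f (x + a)))"
    by (subst sum.reindex) auto
  also have "\<dots> = (\<Sum>x\<in>H. - sign (f x))"
  proof (rule sum.cong)
    fix x assume "x \<in> H"
    then have "f (x + a) = f x + 1" using f a by (simp add: additive_on_def)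
    then show "sign (f (x + a)) = - sign (f x)" by (cases "f x") (simp_all add: sign_def)
  qed simp
  finally show ?thesis using False by (auto simp: sum_negf)
qed

text \<open>Duality for a possibly degenerate pairing: both sides count
  \<open>\<Sum>x\<in>C. \<Sum>y\<in>D. (-1)\<^bsup>b x y\<^esup>\<close>, summed in the two orders.\<close>
lemma card_annihilators:
  fixes b :: "'a::{finite,ab_group_add} \<Rightarrow> 'b::{finite,ab_group_add} \<Rightarrow> bit"
  assumes C: "add_subgroup C" and D: "add_subgroup D"
    and left: "\<And>y. y \<in> D \<Longrightarrow> additive_on C (\<lambda>x. b x y)"
    and right: "\<And>x. x \<in> C \<Longrightarrow> additive_on D (b x)"
  shows "card C * card {y \<in> D. \<forall>x\<in>C. b x y = 0} = card D * card {x \<in> C. \<forall>y\<in>D. b x y = 0}"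
proof -
  have "(\<Sum>x\<in>C. \<Sum>y\<in>D. sign (b x y))
      = (\<Sum>x\<in>C. if \<forall>y\<in>D. b x y = 0 then int (card D) else 0)"
    using right D by (simp add: sum_sign_additive)
  also have "\<dots> = int (card D * card {x \<in> C. \<forall>y\<in>D. b x y = 0})"
    by (simp add: sum.If_cases Collect_conj_eq)
  finally have 1: "(\<Sum>x\<in>C. \<Sum>y\<in>D. sign (b x y)) = \<dots>" .
  have "(\<Sum>y\<in>D. \<Sum>x\<in>C. sign (b x y))
      = (\<Sum>y\<in>D. if \<forall>x\<in>C. b x y = 0 then int (card C) else 0)"
    using left C by (simp add: sum_sign_additive)
  also have "\<dots> = int (card C * card {y \<in> D. \<forall>x\<in>C. b x y = 0})"
    by (simp add: sum.If_cases Collect_conj_eq)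
  finally have 2: "(\<Sum>y\<in>D. \<Sum>x\<in>C. sign (b x y)) = \<dots>" .
  show ?thesis using 1 2 sum.swap[of "\<lambda>x y. sign (b x y)" D C] by linarith
qed

text \<open>In a group of exponent two, the subgroup generated by \<open>U\<close> and \<open>v\<close>. The second disjunct
  is \<open>x \<in> U + v\<close> without an existential quantifier.\<close>
definition adjoin :: "'a::ab_group_add \<Rightarrow> 'a set \<Rightarrow> 'a set"
  where "adjoin v U = {x. x \<in> U \<or> x + v \<in> U}"

text \<open>A symmetric bilinear form on a finite vector space over \<open>\<int>\<^sub>2\<close>. Such a space is the same as a
  finite additive group of exponent two; this generality covers \<^typ>\<open>bit ^ 'n\<close> and its
  product with \<^typ>\<open>bit\<close> alike.\<close>
locale binary_form =
  fixes S :: "'v::{finite,ab_group_add} \<Rightarrow> 'v \<Rightarrow> bit"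
  assumes double: "x + x = (0 :: 'v)"
    and sym: "S x y = S y x"
    and add_right: "S x (y + z) = S x y + S x z"
begin

lemma add_left: "S (x + y) z = S x z + S y z"
  by (simp only: sym[of _ z] add_right)

lemma cancel [simp]: "x + v + v = (x :: 'v)" "v + (v + x) = x"
  by (simp_all only: double add.assoc add_0_right flip: add.assoc[of v v x]) (simp only: double add_0_left)

lemma add_eq_zero_iff: "x + y = 0 \<longleftrightarrow> x = (y :: 'v)"
proof
  assume "x + y = 0"
  moreover have "x + y + y = x" by (rule cancel)
  ultimately have "0 + y = x" by (rule subst)
  then show "x = y" by (subst (asm) add_0) (rule HOL.sym)
next
  assume "x = y"
  then show "x + y = 0" by (rule ssubst) (rule double)
qed

lemma cancel_pair: "(x + v) + (y + v) = x + (y :: 'v)"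
proof -
  have "(x + v) + (y + v) = (x + y) + (v + v)" by (simp only: ac_simps)
  then show ?thesis by (simp add: double)
qed

lemma mem_add_iff:
  fixes x :: 'v
  assumes U: "add_subgroup U" and x: "x \<in> U"
  shows "x + y \<in> U \<longleftrightarrow> y \<in> U" "y + x \<in> U \<longleftrightarrow> y \<in> U"
proof -
  have add: "a + b \<in> U" if "a \<in> U" "b \<in> U" for a b
    using U that by (simp add: add_subgroup_def)
  show 1: "x + y \<in> U \<longleftrightarrow> y \<in> U"
  proof
    assume "x + y \<in> U"
    then have "x + (x + y) \<in> U" by (rule add[OF x])
    then show "y \<in> U" by (simp only: cancel)
  qed (rule add[OF x])
  then show "y + x \<in> U \<longleftrightarrow> y \<in> U"
    by (subst add.commute)
qed

lemma add_mem_if_shifts_mem: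
  assumes U: "add_subgroup (U :: 'v set)" and x: "x + v \<in> U" and y: "y + v \<in> U"
  shows "x + y \<in> U"
proof -
  have "(x + v) + (y + v) \<in> U" using assms by (simp only: add_subgroup_def)
  then show ?thesis by (simp only: cancel_pair)
qed

lemma add_subgroup_adjoin:
  assumes U: "add_subgroup (U :: 'v set)"
  shows "add_subgroup (adjoin v U)"
proof -
  have "x + y \<in> adjoin v U" if "x \<in> adjoin v U" "y \<in> adjoin v U" for x y :: 'v
  proof -
    consider "x \<in> U" | "y \<in> U" | "x + v \<in> U" "y + v \<in> U"
      using \<open>x \<in> adjoin v U\<close> \<open>y \<in> adjoin v U\<close> by (auto simp: adjoin_def)
    then show ?thesis
    proof cases
      case 1
      then show ?thesis using that mem_add_iff[OF U 1] by (simp add: adjoin_def add.assoc)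
    next
      case 2
      have "x + y + v = (x + v) + y" by (simp only: ac_simps)
      then have "x + y + v \<in> U \<longleftrightarrow> x + v \<in> U" by (simp only: mem_add_iff(2)[OF U 2])
      then show ?thesis using that mem_add_iff[OF U 2] by (simp add: adjoin_def)
    next
      case 3
      then have "x + y \<in> U" by (rule add_mem_if_shifts_mem[OF U])
      then show ?thesis by (simp add: adjoin_def)
    qed
  qed
  moreover have "0 \<in> adjoin v U" using U by (simp add: add_subgroup_def adjoin_def)
  ultimately show ?thesis unfolding add_subgroup_def by blast
qed

lemma adjoinE:
  fixes x :: 'v
  assumes "x \<in> adjoin v U"
  obtains r where "r \<in> U" "x = r \<or> x = r + v"
proof (cases "x \<in> U")
  case True
  then show ?thesis using that by blast
next
  case False
  then have "x + v \<in> U" using assms by (simp add: adjoin_def)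
  moreover have "x = x + v \<or> x = x + v + v" by (intro disjI2) (simp only: cancel)
  ultimately show ?thesis by (rule that)
qed

lemma card_adjoin:
  assumes U: "add_subgroup (U :: 'v set)" and v: "v \<notin> U"
  shows "card (adjoin v U) = 2 * card U"
proof -
  have eq: "adjoin v U = U \<union> (\<lambda>x. x + v) ` U"
  proof -
    have "x \<in> (\<lambda>x. x + v) ` U" if "x + v \<in> U" for x
      using image_eqI[of x "\<lambda>x. x + v" "x + v" U] that by simp
    then show ?thesis by (auto simp: adjoin_def)
  qed
  have "U \<inter> (\<lambda>x. x + v) ` U = {}"
    using v mem_add_iff[OF U] by auto
  moreover have "card ((\<lambda>x. x + v) ` U) = card U"
    by (rule card_image) simp
  ultimately show ?thesis unfolding eq by (subst card_Un_disjoint) auto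
qed

definition annihilator :: "'v set \<Rightarrow> 'v set"
  where "annihilator U = {y. \<forall>x\<in>U. S x y = 0}"

lemma S_zero [simp]: "S x 0 = 0" "S 0 x = 0"
proof -
  show 0: "S x 0 = 0" using add_right[of x 0 0] by simp
  show "S 0 x = 0" by (subst sym) (fact 0)
qed

lemma add_subgroup_annihilator: "add_subgroup (annihilator U)"
  by (simp add: add_subgroup_def annihilator_def add_right)

lemma card_annihilator:
  assumes U: "add_subgroup U"
  shows "card U * card (annihilator U) = CARD('v) * card (U \<inter> annihilator UNIV)"
proof -
  have "U \<inter> annihilator UNIV = {x \<in> U. \<forall>y\<in>UNIV. S x y = 0}"
  proof -
    have "(\<forall>x. S x y = 0) \<longleftrightarrow> (\<forall>x. S y x = 0)" for y
      by (simp only: sym[of y])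
    then show ?thesis by (auto simp: annihilator_def)
  qed
  moreover have "annihilator U = {y \<in> UNIV. \<forall>x\<in>U. S x y = 0}"
    by (simp add: annihilator_def)
  ultimately show ?thesis
    using card_annihilators[of U UNIV S] U
    by (simp add: additive_on_def add_right add_left add_subgroup_def)
qed

end

section \<open>The dot product\<close>

interpretation dot: binary_form "dotp :: bit ^ 'n \<Rightarrow> bit ^ 'n \<Rightarrow> bit"
  by standard (simp_all add: dotp_def ac_simps distrib_left sum.distrib)

lemma dotp_axis [simp]: "dotp (axis i 1) x = x $ i" "dotp x (axis i 1) = x $ i"
  by (simp_all add: dotp_def axis_def if_distrib if_distribR cong: if_cong)

lemma dotp_self: "dotp x x = dotp x 1"
  by (simp add: dotp_def)

lemma dot_annihilator_UNIV: "dot.annihilator UNIV = {0 :: bit ^ 'n}"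
proof -
  have "x = 0" if "\<And>y. dotp y x = 0" for x :: "bit ^ 'n"
    using that[of "axis _ 1"] by (simp add: vec_eq_iff)
  then show ?thesis by (auto simp: dot.annihilator_def)
qed

lemma card_dot_annihilator:
  fixes U :: "(bit ^ 'n) set"
  assumes "add_subgroup U"
  shows "card U * card (dot.annihilator U) = 2 ^ CARD('n)"
proof -
  have "U \<inter> {0} = {0}" using assms by (auto simp: add_subgroup_def)
  then show ?thesis using dot.card_annihilator[OF assms] by (simp add: dot_annihilator_UNIV)
qed

lemma additive_on_zero:
  assumes "add_subgroup U" "additive_on U g"
  shows "g 0 = 0"
proof -
  have "g (0 + 0) = g 0 + g 0" using assms unfolding add_subgroup_def additive_on_def by blast
  then show ?thesis by simp
qed

lemma add_subgroup_image:
  assumes "add_subgroup U" "additive_on U g"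
  shows "add_subgroup (g ` U)"
  using assms additive_on_zero[OF assms] unfolding add_subgroup_def additive_on_def
  by (smt (verit, best) image_iff)

lemma additive_on_inj_on:
  fixes g :: "'a::{finite,ab_group_add} \<Rightarrow> bit ^ 'n"
  assumes U: "add_subgroup U" and g: "additive_on U g"
    and ker: "\<forall>x\<in>U. g x = 0 \<longrightarrow> x = 0" and double: "\<And>x :: 'a. x + x = 0"
  shows "inj_on g U"
proof (rule inj_onI)
  fix x y assume xy: "x \<in> U" "y \<in> U" "g x = g y"
  have "g (x + y) = 0" using xy g by (simp add: additive_on_def)
  then have "x + y = 0" using ker U xy by (simp add: add_subgroup_def)
  then show "x = y" using double[of y] by (metis add_right_cancel)
qed

text \<open>An injective \<open>g\<close> imposes independent linear conditions on \<open>a\<close>, so any additive right-hand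
  side is attained. To obtain this from counting, homogenize: the pairs \<open>(a, t)\<close> with
  \<open>(g x, a) = t \<phi>(x)\<close> on \<open>U\<close> are twice as many as those with \<open>t = 0\<close>, so some have \<open>t = 1\<close>.\<close>
lemma dot_solvable:
  fixes g :: "'a::{finite,ab_group_add} \<Rightarrow> bit ^ 'n"
  assumes U: "add_subgroup U" and g: "additive_on U g"
    and ker: "\<forall>x\<in>U. g x = 0 \<longrightarrow> x = 0" and double: "\<And>x :: 'a. x + x = 0"
    and \<phi>: "additive_on U \<phi>"
  shows "\<exists>a. \<forall>x\<in>U. dotp (g x) a = \<phi> x"
proof (rule ccontr)
  assume unsolvable: "\<not> ?thesis"
  \<comment> \<open>Over \<open>\<int>\<^sub>2\<close> the equation \<open>(g x, a) = t \<phi>(x)\<close> reads \<open>b x (a, t) = 0\<close>.\<close>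
  define b where "b x p = dotp (g x) (fst p) + snd p * \<phi> x" for x and p :: "(bit ^ 'n) \<times> bit"
  have "card U * card {p \<in> UNIV. \<forall>x\<in>U. b x p = 0}
      = card (UNIV :: ((bit ^ 'n) \<times> bit) set) * card {x \<in> U. \<forall>p\<in>UNIV. b x p = 0}"
  proof (rule card_annihilators)
    show "additive_on U (\<lambda>x. b x p)" for p
      using g \<phi> by (simp add: additive_on_def b_def dot.add_left algebra_simps)
    show "additive_on UNIV (b x)" for x
      by (simp add: additive_on_def b_def dot.add_right algebra_simps)
  qed (use U in \<open>simp_all add: add_subgroup_def\<close>)
  moreover have "{x \<in> U. \<forall>p\<in>UNIV. b x p = 0} = {0}"
  proof -
    have "x = 0" if x: "x \<in> U" and "\<And>p. b x p = 0" for x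
    proof -
      have "dotp (g x) (axis i 1) = 0" for i
        using that(2)[of "(axis i 1, 0)"] by (simp add: b_def)
      then have "g x = 0" by (simp add: vec_eq_iff)
      then show ?thesis using ker x by simp
    qed
    moreover have "g 0 = 0" "\<phi> 0 = 0" using additive_on_zero U g \<phi> by blast+
    ultimately show ?thesis using U by (auto simp: b_def add_subgroup_def)
  qed
  moreover have "{p \<in> UNIV. \<forall>x\<in>U. b x p = 0} = dot.annihilator (g ` U) \<times> {0}"
  proof -
    have snd_zero: "snd p = 0" if "\<And>x. x \<in> U \<Longrightarrow> b x p = 0" for p
    proof (rule ccontr)
      assume "snd p \<noteq> 0"
      then have p: "snd p = 1" by simp
      have "dotp (g x) (fst p) = \<phi> x" if "x \<in> U" for x
        using \<open>\<And>x. x \<in> U \<Longrightarrow> b x p = 0\<close>[OF that] p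
        by (cases "\<phi> x") (simp_all add: b_def)
      then show False using unsolvable by blast
    qed
    then have "(\<forall>x\<in>U. b x p = 0) \<longleftrightarrow> fst p \<in> dot.annihilator (g ` U) \<and> snd p = 0" for p
    proof (cases "snd p = 0")
      case True
      then show ?thesis by (simp add: b_def dot.annihilator_def)
    next
      case False
      then show ?thesis using snd_zero by blast
    qed
    then show ?thesis by (simp add: set_eq_iff mem_Times_iff)
  qed
  moreover have "card U = card (g ` U)"
    using additive_on_inj_on[OF U g ker double] by (simp add: card_image)
  ultimately show False
    using card_dot_annihilator[OF add_subgroup_image[OF U g]] by (simp add: card_cartesian_product)
qed

section \<open>Extending isometric embeddings\<close>

context binary_form
begin

definition embeds_on :: "'v set \<Rightarrow> ('v \<Rightarrow> bit ^ 'k) \<Rightarrow> bool"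
  where "embeds_on U g \<longleftrightarrow> additive_on U g \<and> (\<forall>x\<in>U. g x = 0 \<longrightarrow> x = 0)
    \<and> (\<forall>x\<in>U. \<forall>y\<in>U. dotp (g x) (g y) = S x y)"

text \<open>One step of the extension: \<open>v\<close> is sent to \<open>a\<close>. The last condition on \<open>a\<close> keeps the extended
  map injective.\<close>
lemma embeds_on_adjoin:
  fixes g :: "'v \<Rightarrow> bit ^ 'k"
  assumes U: "add_subgroup U" and g: "embeds_on U g"
    and a: "\<And>x. x \<in> U \<Longrightarrow> dotp (g x) a = S x v" "dotp a a = S v v" "a \<notin> g ` U"
  defines "g' \<equiv> \<lambda>x. if x \<in> U then g x else g (x + v) + a"
  shows "embeds_on (adjoin v U) g'"
proof -
  have add: "g (x + y) = g x + g y" if "x \<in> U" "y \<in> U" for x y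
    using g that by (simp add: embeds_on_def additive_on_def)
  have dotp: "dotp (g x) (g y) = S x y" if "x \<in> U" "y \<in> U" for x y
    using g that by (simp add: embeds_on_def)
  have dotp': "dotp a (g x) = S x v" if "x \<in> U" for x
    by (subst dot.sym) (rule a(1)[OF that])
  have S_shift: "S x y = S x (y + v) + S x v" for x y
    by (simp only: cancel flip: add_right)
  have g'_out: "g' x = g (x + v) + a \<and> x + v \<in> U" if "x \<in> adjoin v U" "x \<notin> U" for x
    using that by (auto simp: g'_def adjoin_def)
  have g'_in: "g' x = g x" if "x \<in> U" for x
    using that by (simp add: g'_def)
  have mixed: "g' (x + y) = g' x + g' y \<and> dotp (g' x) (g' y) = S x y"
    if x: "x \<in> U" and y: "y \<in> adjoin v U" "y \<notin> U" for x y
  proof -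
    note gy = g'_out[OF y]
    have "x + y \<notin> U" using mem_add_iff[OF U x] y by simp
    then have "g' (x + y) = g (x + (y + v)) + a" by (simp add: g'_def add.assoc)
    then have "g' (x + y) = g' x + g' y" using gy x by (simp add: add g'_in)
    moreover have "dotp (g' x) (g' y) = S x y"
      using gy x S_shift[of x y] by (simp only: g'_in dot.add_right dotp a)
    ultimately show ?thesis by simp
  qed
  have "g' (x + y) = g' x + g' y \<and> dotp (g' x) (g' y) = S x y"
    if xy: "x \<in> adjoin v U" "y \<in> adjoin v U" for x y
  proof (cases "x \<in> U"; cases "y \<in> U")
    assume "x \<in> U" "y \<in> U"
    then show ?thesis using U by (simp add: add_subgroup_def g'_in add dotp)
  next
    assume "x \<in> U" "y \<notin> U"
    then show ?thesis using mixed xy by simp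
  next
    assume x: "x \<notin> U" and y: "y \<in> U"
    show ?thesis
      using mixed[OF y xy(1) x] by (simp only: add.commute[of x y] add.commute[of "g' x"]
          dot.sym[of "g' x"] sym[of x])
  next
    assume out: "x \<notin> U" "y \<notin> U"
    note gx = g'_out[OF xy(1) out(1)] and gy = g'_out[OF xy(2) out(2)]
    have xyU: "x + y \<in> U" using add_mem_if_shifts_mem[OF U] gx gy by blast
    have "g' (x + y) = g ((x + v) + (y + v))"
      unfolding cancel_pair using xyU by (rule g'_in)
    also have "\<dots> = g (x + v) + g (y + v)"
      using gx gy by (simp only: add)
    also have "\<dots> = g' x + g' y"
      using gx gy by (simp only: dot.cancel_pair)
    finally have "g' (x + y) = g' x + g' y" .
    moreover have "dotp (g' x) (g' y) = S x y"
    proof -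
      have "dotp a (g (y + v)) = S v (y + v)" using dotp' gy by (simp only: sym)
      then have "dotp (g' x) (g' y) = (S (x + v) (y + v) + S v (y + v)) + (S (x + v) v + S v v)"
        using gx gy by (simp only: dot.add_right dot.add_left dotp a)
      also have "\<dots> = S x y"
        by (simp only: cancel flip: add_right add_left)
      finally show ?thesis .
    qed
    ultimately show ?thesis by simp
  qed
  moreover have "x = 0" if x: "x \<in> adjoin v U" "g' x = 0" for x
  proof (cases "x \<in> U")
    case True
    then show ?thesis using x g by (simp add: g'_in embeds_on_def)
  next
    case False
    then have "g (x + v) + a = 0" "x + v \<in> U" using g'_out[OF x(1)] x(2) by auto
    then have "a = g (x + v)" by (simp only: dot.add_eq_zero_iff)
    then show ?thesis using a(3) \<open>x + v \<in> U\<close> by blast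
  qed
  ultimately show ?thesis unfolding embeds_on_def additive_on_def by blast
qed

text \<open>
  A Witt extension theorem. Domains grow by one vector \<open>v\<close> at a time, whose image must satisfy the
  linear conditions imposed by \<open>U\<close> and avoid \<open>g ` U\<close>. Suppose no solution avoids it. Let
  \<open>R = U \<inter> U\<^sup>\<bottom>\<close>. Subtracting from \<open>v\<close> the preimage \<open>w\<close> of one solution gives \<open>z \<notin> U\<close>
  orthogonal to \<open>U\<close>, and to itself because \<open>(z, z) = (z, u)\<close>. The complement of \<open>g ` U\<close> lies in
  \<open>g ` R\<close>, so \<open>2\<^sup>K \<le> |U| |R|\<close>. Now \<open>R + \<langle>z\<rangle>\<close> is orthogonal to \<open>U' = U + \<langle>z\<rangle>\<close>, and both are
  twice as large as \<open>R\<close> and \<open>U\<close>, so \<open>4 \<cdot> 2\<^sup>K \<le> |U'| |U'\<^sup>\<bottom>| \<le> |V| |rad V|\<close>.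
\<close>
theorem extend_embedding:
  fixes g :: "'v \<Rightarrow> bit ^ 'k"
  assumes U: "add_subgroup U" and g: "embeds_on U g"
    and u: "u \<in> U" "g u = 1" "\<And>x. S x x = S x u"
    and small: "CARD('v) * card (annihilator UNIV) < 4 * 2 ^ CARD('k)"
  shows "\<exists>h. embeds_on UNIV h \<and> (\<forall>x\<in>U. h x = g x)"
  using U g u(1,2)
proof (induction "card (- U)" arbitrary: U g rule: less_induct)
  case less
  note U = \<open>add_subgroup U\<close> and g = \<open>embeds_on U g\<close>
  show ?case
  proof (cases "U = UNIV")
    case True
    then show ?thesis using g by blast
  next
    case False
    then obtain v where v: "v \<notin> U" by auto
    have add: "additive_on U g" and ker: "\<forall>x\<in>U. g x = 0 \<longrightarrow> x = 0"
      and iso: "\<And>x y. x \<in> U \<Longrightarrow> y \<in> U \<Longrightarrow> dotp (g x) (g y) = S x y"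
      using g by (auto simp: embeds_on_def)
    have "additive_on U (\<lambda>x. S x v)" by (simp add: additive_on_def add_left)
    from dot_solvable[OF U add ker double this]
    obtain a\<^sub>0 where a\<^sub>0: "\<And>x. x \<in> U \<Longrightarrow> dotp (g x) a\<^sub>0 = S x v" by blast
    have "\<exists>a. (\<forall>x\<in>U. dotp (g x) a = S x v) \<and> a \<notin> g ` U"
    proof (rule ccontr)
      assume "\<not> ?thesis"
      then have covered: "a \<in> g ` U" if "\<And>x. x \<in> U \<Longrightarrow> dotp (g x) a = S x v" for a
        using that by blast
      obtain w where w: "w \<in> U" "a\<^sub>0 = g w" using covered a\<^sub>0 by blast
      define z where "z = v + w"
      have z: "z \<notin> U" unfolding z_def using v mem_add_iff[OF U w(1)] by simp
      have Sz: "S x z = 0" if "x \<in> U" for x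
        using a\<^sub>0[OF that] iso[OF that w(1)] w(2) by (simp add: z_def add_right)
      define R where "R = U \<inter> annihilator U"
      have R: "add_subgroup R"
        using U add_subgroup_annihilator[of U] by (simp add: R_def add_subgroup_def)
      have imU: "add_subgroup (g ` U)" using add_subgroup_image[OF U add] .
      have "dot.annihilator (g ` U) \<subseteq> g ` R"
      proof
        fix y assume y: "y \<in> dot.annihilator (g ` U)"
        have "y + a\<^sub>0 \<in> g ` U"
        proof (rule covered)
          fix x assume "x \<in> U"
          then show "dotp (g x) (y + a\<^sub>0) = S x v"
            using y a\<^sub>0 by (simp add: dot.annihilator_def dot.add_right)
        qed
        then have "y \<in> g ` U" using dot.mem_add_iff(2)[OF imU, of a\<^sub>0 y] w by blast
        then obtain x where x: "x \<in> U" "y = g x" by blast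
        have "S x' x = 0" if "x' \<in> U" for x'
          using y x iso[OF that x(1)] that by (simp add: dot.annihilator_def)
        then show "y \<in> g ` R" using x by (auto simp: R_def annihilator_def)
      qed
      then have "card (dot.annihilator (g ` U)) \<le> card R"
        by (meson card_image_le card_mono finite le_trans)
      moreover have "card (g ` U) = card U"
        using additive_on_inj_on[OF U add ker double] by (rule card_image)
      ultimately have large: "2 ^ CARD('k) \<le> card U * card R"
        using card_dot_annihilator[OF imU] by (metis mult_le_mono2)
      have "card (adjoin z R) = 2 * card R"
        using card_adjoin[OF R] z by (simp add: R_def)
      moreover have "card (adjoin z R) \<le> card (annihilator (adjoin z U))"
      proof (rule card_mono)
        have Szz: "S z z = 0"
          using Sz[OF less.prems(3)] by (simp only: u(3)[of z] sym[of z u])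
        show "adjoin z R \<subseteq> annihilator (adjoin z U)"
        proof
          fix y assume "y \<in> adjoin z R"
          then obtain r where r: "r \<in> R" and "y = r \<or> y = r + z"
            by (rule adjoinE)
          moreover have "S x r = 0" "S x z = 0" if "x \<in> U" for x
            using r Sz that by (simp_all add: R_def annihilator_def)
          moreover have "S z r = 0"
            using r Sz by (simp add: R_def sym[of z r])
          ultimately have Uy: "S x y = 0" and zy: "S z y = 0" if "x \<in> U" for x
            using Szz that by (auto simp: add_right)
          have "S x y = 0" if "x \<in> adjoin z U" for x
          proof -
            obtain x' where "x' \<in> U" "x = x' \<or> x = x' + z"
              using \<open>x \<in> adjoin z U\<close> by (rule adjoinE)
            then show ?thesis using Uy zy by (auto simp: add_left)
          qed
          then show "y \<in> annihilator (adjoin z U)" by (simp add: annihilator_def)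
        qed
      qed simp
      ultimately have "2 * card R \<le> card (annihilator (adjoin z U))" by simp
      have "4 * 2 ^ CARD('k) \<le> (2 * card U) * (2 * card R)" using large by simp
      also have "\<dots> \<le> card (adjoin z U) * card (annihilator (adjoin z U))"
        unfolding card_adjoin[OF U z] by (rule mult_le_mono2) fact
      also have "\<dots> = CARD('v) * card (adjoin z U \<inter> annihilator UNIV)"
        using card_annihilator[OF add_subgroup_adjoin[OF U]] .
      also have "\<dots> \<le> CARD('v) * card (annihilator UNIV)"
        by (intro mult_le_mono2 card_mono) auto
      finally show False using small by simp
    qed
    then obtain a where a: "\<And>x. x \<in> U \<Longrightarrow> dotp (g x) a = S x v" "a \<notin> g ` U" by blast
    \<comment> \<open>The self-product comes for free: \<open>(a, a) = (a, g u) = S v u = S v v\<close>.\<close>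
    have "dotp a a = S v v"
      using a(1)[OF less.prems(3)] less.prems(4)
      by (simp only: dotp_self[of a] dot.sym[of a 1] u(3)[of v] sym[of v u])
    note ext = embeds_on_adjoin[OF U g a(1) this a(2)]
    have "v \<in> adjoin v U" using U by (simp add: adjoin_def double add_subgroup_def)
    then have "card (- adjoin v U) < card (- U)"
      using v by (intro psubset_card_mono) (auto simp: adjoin_def)
    from less.hyps[OF this add_subgroup_adjoin[OF U] ext] obtain h where
      "embeds_on UNIV h" "\<forall>x\<in>adjoin v U. h x = (if x \<in> U then g x else g (x + v) + a)"
      using less.prems(3,4) by (auto simp: adjoin_def)
    then show ?thesis by (auto simp: adjoin_def)
  qed
qed

end

section \<open>The form of a symmetric matrix\<close>

lemma card_span_bit:
  fixes B :: "(bit ^ 'n) set"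
  assumes "vec.independent B"
  shows "card (vec.span B) = 2 ^ card B"
proof -
  have "finite B" by simp
  then show ?thesis using assms
  proof (induction B)
    case empty
    then show ?case by simp
  next
    case (insert a B)
    have sub: "add_subgroup (vec.span B)"
      by (simp add: add_subgroup_def vec.span_zero vec.span_add)
    have "vec.span (insert a B) = adjoin a (vec.span B)"
    proof -
      have "(\<exists>k. x - k *s a \<in> vec.span B) \<longleftrightarrow> x \<in> vec.span B \<or> x + a \<in> vec.span B" for x
      proof -
        have "(\<exists>k. x - k *s a \<in> vec.span B) \<longleftrightarrow>
            x - 0 *s a \<in> vec.span B \<or> x - 1 *s a \<in> vec.span B"
          by (metis bit.exhaust)
        moreover have "x - a = x + a" by (simp add: vec_eq_iff)
        ultimately show ?thesis by simp
      qed
      then show ?thesis by (simp add: vec.span_insert adjoin_def)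
    qed
    moreover have "a \<notin> vec.span B" "vec.independent B"
      using insert.prems insert.hyps by (simp_all add: vec.independent_insert)
    ultimately show ?case using dot.card_adjoin[OF sub] insert by simp
  qed
qed

text \<open>Rank and nullity, with \<open>ker S\<close> as the annihilator of the row space. The kernel is the radical
  of the form when \<open>S\<close> is symmetric.\<close>
lemma card_kernel:
  fixes S :: "bit ^ 'n ^ 'm"
  shows "2 ^ rank S * card {x. S *v x = 0} = (2 ^ CARD('n) :: nat)"
proof -
  obtain B where B: "vec.independent B" "B \<subseteq> rows S" "rows S \<subseteq> vec.span B" "card B = vec.dim (rows S)"
    using vec.basis_exists by metis
  have span: "vec.span (rows S) = vec.span B"
    using B(2,3) by (metis vec.span_mono vec.span_span subset_antisym)
  have "card (vec.span (rows S)) = 2 ^ rank S"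
    using card_span_bit[OF B(1)] B(4) by (simp add: span row_rank_def_gen)
  moreover have "dot.annihilator (vec.span (rows S)) = {x. S *v x = 0}"
  proof -
    have "(\<forall>y\<in>vec.span (rows S). dotp y x = 0) \<longleftrightarrow> S *v x = 0" for x
    proof
      assume *: "\<forall>y\<in>vec.span (rows S). dotp y x = 0"
      have "dotp (row i S) x = 0" for i
        using * vec.span_base[of "row i S" "rows S"] by (auto simp: rows_def)
      then show "S *v x = 0"
        by (simp add: vec_eq_iff dotp_def row_def matrix_vector_mult_def)
    next
      assume 0: "S *v x = 0"
      show "\<forall>y\<in>vec.span (rows S). dotp y x = 0"
      proof
        fix y assume "y \<in> vec.span (rows S)"
        then show "dotp y x = 0"
        proof (induction rule: vec.span_induct_alt)
          case base
          then show ?case by simp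
        next
          case (step c r y)
          then obtain i where "r = row i S" by (auto simp: rows_def)
          then have "dotp r x = 0"
            using 0 by (simp add: vec_eq_iff dotp_def row_def matrix_vector_mult_def)
          then show ?case using step by (cases c) (simp_all add: dot.add_left)
        qed
      qed
    qed
    then show ?thesis by (simp add: dot.annihilator_def)
  qed
  moreover have "add_subgroup (vec.span (rows S))"
    by (simp add: add_subgroup_def vec.span_zero vec.span_add)
  ultimately show ?thesis using card_dot_annihilator by metis
qed

lemma rank_le_CARD:
  fixes S :: "bit ^ 'n ^ 'm"
  shows "rank S \<le> CARD('n)"
  unfolding row_rank_def_gen using vec.dim_subset[OF subset_UNIV, of "rows S"] by (simp only: vec_dim_card)

definition matrix_form :: "bit ^ 'd ^ 'd \<Rightarrow> bit ^ 'd \<Rightarrow> bit ^ 'd \<Rightarrow> bit"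
  where "matrix_form S x y = dotp x (S *v y)"

lemma dotp_matrix_transpose: "dotp x (S *v y) = dotp (transpose S *v x) y"
proof -
  have "dotp x (S *v y) = (\<Sum>i\<in>UNIV. \<Sum>j\<in>UNIV. x $ i * S $ i $ j * y $ j)"
    by (simp add: dotp_def matrix_vector_mult_def sum_distrib_left ac_simps)
  also have "\<dots> = (\<Sum>j\<in>UNIV. \<Sum>i\<in>UNIV. x $ i * S $ i $ j * y $ j)" by (rule sum.swap)
  also have "\<dots> = dotp (transpose S *v x) y"
    by (simp add: dotp_def matrix_vector_mult_def transpose_def sum_distrib_left ac_simps)
  finally show ?thesis .
qed

lemma binary_form_matrix:
  assumes "transpose S = S"
  shows "binary_form (matrix_form S)"
proof
  show "matrix_form S x y = matrix_form S y x" for x y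
    unfolding matrix_form_def dotp_matrix_transpose[of x] assms by (rule dot.sym)
qed (simp_all add: matrix_form_def matrix_vector_right_distrib dot.add_right)

lemma matrix_form_axis: "matrix_form S (axis i 1) (axis j 1) = S $ i $ j"
  by (simp add: matrix_form_def) (simp add: matrix_vector_mult_def axis_def if_distrib cong: if_cong)

text \<open>A binary row has the same product with itself as with the all-ones vector, so the parity of
  the \<open>i\<close>th row is the \<open>i\<close>th entry of \<open>S 1\<close>.\<close>
lemma parity_indicative_row_sum:
  assumes "parity_indicative S"
  shows "S *v 1 = (\<chi> i. S $ i $ i)"
proof -
  have "(S *v 1) $ i = S $ i $ i" for i
  proof -
    have "(S *v 1) $ i = dotp (row i S) (row i S)"
      by (simp add: dotp_self) (simp add: dotp_def matrix_vector_mult_def row_def)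
    moreover have "S $ i $ i = 1 \<longleftrightarrow> dotp (row i S) (row i S) = 1"
      using assms by (simp add: parity_indicative_def even_vec_def)
    ultimately show ?thesis
      by (cases "S $ i $ i"; cases "dotp (row i S) (row i S)") simp_all
  qed
  then show ?thesis by (simp add: vec_eq_iff)
qed

text \<open>The off-diagonal terms of \<open>x\<^sup>* S x\<close> cancel in pairs, so both sides are additive in \<open>x\<close>, and
  they agree on the standard basis.\<close>
lemma matrix_form_self:
  assumes "transpose S = S"
  shows "matrix_form S x x = dotp x (\<chi> i. S $ i $ i)"
proof -
  interpret F: binary_form "matrix_form S" using binary_form_matrix[OF assms] .
  define Q where "Q x = matrix_form S x x + dotp x (\<chi> i. S $ i $ i)" for x
  have Q_add: "Q (x + y) = Q x + Q y" for x y
  proof -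
    have "matrix_form S (x + y) (x + y) = matrix_form S x x + matrix_form S y y"
      unfolding F.add_left F.add_right F.sym[of y x]
      by (cases "matrix_form S x y") (simp_all add: bit_add_cancel)
    then show ?thesis by (simp only: Q_def dot.add_left ac_simps)
  qed
  have Q_sum: "Q (\<Sum>i\<in>A. h i) = (\<Sum>i\<in>A. Q (h i))" if "finite A" for A and h :: "'a \<Rightarrow> _"
    using that by (induction A) (simp_all add: Q_add, simp add: Q_def)
  have "Q (x $ i *s axis i 1) = 0" for x i
    by (cases "x $ i") (simp_all add: Q_def matrix_form_axis)
  then have "Q x = 0" for x
    using Q_sum[of UNIV "\<lambda>i. x $ i *s axis i 1"] by (simp add: basis_expansion)
  then show ?thesis by (simp add: Q_def)
qed

section \<open>Frames from isometric embeddings\<close>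

text \<open>A proper subspace has a nonzero orthogonal vector, since the sizes of a subspace and of its
  complement multiply to \<open>2\<^sup>d\<close>.\<close>
lemma is_frame_if_separating:
  fixes f :: "'k::finite \<Rightarrow> bit ^ 'd"
  assumes "\<And>x. (\<And>j. dotp x (f j) = 0) \<Longrightarrow> x = 0"
  shows "is_frame f"
proof -
  let ?D = "vec.span (range f)"
  have "add_subgroup ?D" by (simp add: add_subgroup_def vec.span_zero vec.span_add)
  then have "card ?D * card (dot.annihilator ?D) = 2 ^ CARD('d)"
    by (rule card_dot_annihilator)
  moreover have "dot.annihilator ?D = {0}"
  proof -
    have "x = 0" if "x \<in> dot.annihilator ?D" for x
    proof (rule assms)
      fix j
      have "f j \<in> ?D" by (simp add: vec.span_base)
      then show "dotp x (f j) = 0" using that by (auto simp: dot.annihilator_def dot.sym)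
    qed
    then show ?thesis by (auto simp: dot.annihilator_def)
  qed
  ultimately have "card ?D = CARD(bit ^ 'd)" by simp
  then show ?thesis unfolding is_frame_def by (simp add: card_eq_UNIV_imp_eq_UNIV)
qed

text \<open>The frame vectors are the columns of the matrix whose rows are the images of the standard
  basis, so \<open>(h x)\<^sub>j = (x, f\<^sub>j)\<close>.\<close>
lemma frame_of_embedding:
  fixes S :: "bit ^ 'd ^ 'd" and h :: "bit ^ 'd \<Rightarrow> bit ^ 'k"
  assumes add: "additive_on UNIV h" and ker: "\<And>x. h x = 0 \<Longrightarrow> x = 0"
    and iso: "\<And>x y. dotp (h x) (h y) = matrix_form S x y" and one: "h 1 = \<alpha>"
  shows "\<exists>f :: 'k \<Rightarrow> bit ^ 'd. is_frame f
           \<and> S = synthesis f ** transpose (synthesis f)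
           \<and> (\<forall>i. dotp (f i) (f i) = \<alpha> $ i)"
proof -
  define f where "f j = (\<chi> i. h (axis i 1) $ j)" for j
  have h_add: "h (x + y) = h x + h y" for x y using add by (simp add: additive_on_def)
  have h_zero: "h 0 = 0" using h_add[of 0 0] by simp
  have h_sum: "h (\<Sum>i\<in>A. p i) = (\<Sum>i\<in>A. h (p i))" if "finite A" for A and p :: "'d \<Rightarrow> _"
    using that by (induction A) (simp_all add: h_add h_zero)
  have h_scale: "h (c *s y) = c *s h y" for c y by (cases c) (simp_all add: h_zero)
  have h_f: "h x $ j = dotp x (f j)" for x j
  proof -
    have "h x = (\<Sum>i\<in>UNIV. x $ i *s h (axis i 1))"
      using h_sum[of UNIV "\<lambda>i. x $ i *s axis i 1"] by (simp add: basis_expansion h_scale)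
    then show ?thesis by (simp add: dotp_def f_def)
  qed
  have "is_frame f"
    using ker by (intro is_frame_if_separating) (simp add: vec_eq_iff h_f)
  moreover have "S = synthesis f ** transpose (synthesis f)"
  proof -
    have "S $ i $ j = (\<Sum>k\<in>UNIV. f k $ i * f k $ j)" for i j
      using iso[of "axis i 1" "axis j 1"] by (simp add: matrix_form_axis dotp_def f_def)
    then show ?thesis
      by (simp add: vec_eq_iff matrix_matrix_mult_def synthesis_def transpose_def)
  qed
  moreover have "dotp (f j) (f j) = \<alpha> $ j" for j
    using h_f[of 1 j] one dot.sym dotp_self by metis
  ultimately show ?thesis by blast
qed

theorem corollary4p16:
  fixes S :: "bit ^ 'd ^ 'd" and \<alpha> :: "bit ^ 'k"
  assumes "transpose S = S"
    and "parity_indicative S"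
    and "CARD('k) > 2 * CARD('d) - rank S"
    and "\<alpha> \<noteq> 0"
    and "of_nat (norm0 \<alpha>) = trace S"
  shows "\<exists>f :: 'k \<Rightarrow> bit ^ 'd. is_frame f
           \<and> S = synthesis f ** transpose (synthesis f)
           \<and> (\<forall>i. dotp (f i) (f i) = \<alpha> $ i)"
proof -
  interpret F: binary_form "matrix_form S" using binary_form_matrix[OF assms(1)] .
  have char: "matrix_form S x x = matrix_form S x 1" for x
    using matrix_form_self[OF assms(1)] parity_indicative_row_sum[OF assms(2)]
    by (simp add: matrix_form_def)
  have \<alpha>\<alpha>: "dotp \<alpha> \<alpha> = matrix_form S 1 1"
  proof -
    have "dotp \<alpha> \<alpha> = (\<Sum>i\<in>{i. \<alpha> $ i \<noteq> 0}. 1)"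
      unfolding dotp_def by (rule sum.mono_neutral_cong_right) auto
    also have "\<dots> = trace S" using assms(5) by (simp add: norm0_def)
    also have "\<dots> = matrix_form S 1 1"
      using matrix_form_self[OF assms(1), of 1] by (simp add: dotp_def trace_def)
    finally show ?thesis .
  qed
  have one_nz: "(1 :: bit ^ 'd) \<noteq> 0" by (simp add: vec_eq_iff)
  have rad: "F.annihilator UNIV = {x. S *v x = 0}"
    using dot_annihilator_UNIV by (auto simp: F.annihilator_def matrix_form_def dot.annihilator_def)
  have small: "2 ^ CARD('d) * card (F.annihilator UNIV) < (2 ^ CARD('k) :: nat)"
  proof -
    have "2 ^ rank S * card (F.annihilator UNIV) = (2 ^ rank S * 2 ^ (CARD('d) - rank S) :: nat)"
      using card_kernel[of S] rank_le_CARD[of S] by (simp add: rad flip: power_add)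
    then have "card (F.annihilator UNIV) = 2 ^ (CARD('d) - rank S)" by simp
    then show ?thesis
      using assms(3) rank_le_CARD[of S] by (simp flip: power_add)
  qed
  show ?thesis
  proof (cases "\<alpha> = 1")
    case True
    let ?g = "\<lambda>x. if x = 0 then 0 else \<alpha>"
    have "add_subgroup {0, 1 :: bit ^ 'd}" by (simp add: add_subgroup_def)
    moreover have "F.embeds_on {0, 1} ?g"
      using assms(4) \<alpha>\<alpha> by (simp add: F.embeds_on_def additive_on_def)
    ultimately obtain h where "F.embeds_on UNIV h" "\<forall>x\<in>{0, 1}. h x = ?g x"
      using F.extend_embedding[of "{0, 1}" ?g 1] True char small one_nz by auto
    then show ?thesis
      using one_nz by (intro frame_of_embedding[of h S]) (auto simp: F.embeds_on_def)
  next
    case False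
    \<comment> \<open>The orthogonal summand of the enlarged form is the \<^typ>\<open>bit\<close> factor, sent to \<open>\<beta>\<close>.\<close>
    define \<beta> where "\<beta> = 1 + \<alpha>"
    have \<beta>: "\<beta> \<noteq> 0" "\<alpha> + \<beta> = 1"
      using False dot.cancel(2)[of \<alpha> 1] dot.cancel(1)[of 1 \<alpha>]
      by (auto simp: \<beta>_def ac_simps vec_eq_iff)
    have \<alpha>\<beta>: "dotp \<alpha> \<beta> = 0" "dotp \<beta> \<alpha> = 0"
      using dotp_self[of \<alpha>] dot.sym[of \<alpha> \<beta>] by (simp_all add: \<beta>_def dot.add_right)
    have one_plus: "1 + \<beta> = \<alpha>" "1 + \<alpha> = \<beta>"
      by (simp_all only: \<beta>_def dot.cancel)
    have dot_one: "dotp x 1 = dotp x x" "dotp 1 x = dotp x x" for x :: "bit ^ 'k"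
      using dotp_self[of x] dot.sym[of 1 x] by (simp_all only:)
    have dot_one_one: "dotp 1 (1 :: bit ^ 'k) = dotp \<beta> \<beta> + matrix_form S 1 1"
      unfolding \<beta>(2)[symmetric] by (simp add: dot.add_left dot.add_right \<alpha>\<beta> \<alpha>\<alpha> add.commute)
    define T where "T p q = matrix_form S (fst p) (fst q) + snd p * snd q * dotp \<beta> \<beta>" for p q
    interpret T: binary_form T
    proof
      show "T p q = T q p" for p q using F.sym by (simp add: T_def ac_simps)
    qed (simp_all add: T_def F.add_right algebra_simps prod_eq_iff)
    let ?U = "{0, 1} \<times> {0, 1} :: ((bit ^ 'd) \<times> bit) set"
    let ?g = "\<lambda>(x, t). (if x = 0 then 0 else \<alpha>) + t *s \<beta>"
    have "add_subgroup ?U" by (auto simp: add_subgroup_def zero_prod_def)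
    moreover have "T.embeds_on ?U ?g"
      using one_plus dot_one[of \<alpha>] dot_one[of \<beta>] dot_one_one assms(4) \<beta> \<alpha>\<alpha> \<alpha>\<beta> one_nz
      by (auto simp: T.embeds_on_def additive_on_def T_def dot.add_left dot.add_right ac_simps zero_prod_def)
    moreover have "T p p = T p (1, 1)" for p
      by (simp add: T_def char)
    moreover have "CARD((bit ^ 'd) \<times> bit) * card (T.annihilator UNIV) < 4 * 2 ^ CARD('k)"
    proof -
      have "T.annihilator UNIV \<subseteq> F.annihilator UNIV \<times> UNIV"
      proof clarify
        fix x t assume "(x, t) \<in> T.annihilator UNIV"
        then have "T (y, 0) (x, t) = 0" for y by (simp add: T.annihilator_def)
        then show "x \<in> F.annihilator UNIV \<and> t \<in> UNIV" by (simp add: T_def F.annihilator_def)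
      qed
      then have "card (T.annihilator UNIV) \<le> card (F.annihilator UNIV \<times> (UNIV :: bit set))"
        by (intro card_mono) auto
      then have "card (T.annihilator UNIV) \<le> 2 * card (F.annihilator UNIV)"
        by (simp add: card_cartesian_product)
      then have "2 * 2 ^ CARD('d) * card (T.annihilator UNIV)
          \<le> 2 * 2 ^ CARD('d) * (2 * card (F.annihilator UNIV))"
        by (rule mult_le_mono2)
      also have "\<dots> < 4 * 2 ^ CARD('k)" using small by simp
      finally show ?thesis by (simp add: mult.commute)
    qed
    ultimately obtain h where h: "T.embeds_on UNIV h" "\<forall>x\<in>?U. h x = ?g x"
      using T.extend_embedding[of ?U ?g "(1, 1)"] \<beta> one_nz by auto
    show ?thesis
    proof (rule frame_of_embedding[of "\<lambda>x. h (x, 0)"])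
      show "additive_on UNIV (\<lambda>x. h (x, 0))"
        using h(1) unfolding T.embeds_on_def additive_on_def by (metis UNIV_I add_0 add_Pair)
      show "x = 0" if "h (x, 0) = 0" for x
        using h(1) that by (auto simp: T.embeds_on_def zero_prod_def)
      show "dotp (h (x, 0)) (h (y, 0)) = matrix_form S x y" for x y
        using h(1) by (simp add: T.embeds_on_def T_def)
      show "h (1, 0) = \<alpha>" using h(2) one_nz by simp
    qed
  qed
qed

end
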